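(* Statement (AI-fct-rms), given in the context, is deducible from statement (K-asy-rms), given in the context; i.e. (K-asy-rms) implies (AI-fct-rms).
   Context: $\mathbb R_+=[0,\infty)$, $\mathbb R_+^0=(0,\infty)$. Throughout, $X$ is a nonempty set, $d$ a metric on $X$, $\mathcal R\subseteq X\times X$ a reflexive relation, $\mathcal S=\mathcal R\cup\mathcal R^{-1}$, $T:X\to X$ a map, and $\mathrm{Fix}(T)=\{x: Tx=x\}$. Both statements are universally quantified over all such $(X,d,\mathcal R,T)$. (K-asy-rms): if $T$ is strongly $(d,\mathcal R)$-asymptotic and left $(d,\mathcal R)$-continuous, $X$ is $(d,\mathcal R)$-complete, $\mathcal R$ is $d$-almost-selfclosed, and $T$ is $\mathcal R$-increasing and $\mathcal R$-semi-progressive, then $T$ is $\mathcal S^\omega$-global strongly Picard (modulo $(d,\mathcal R)$). (AI-fct-rms): if $T$ is $(d,\mathcal R;\varphi)$-contractive for some $\varphi\in\mathcal F_0(in,re;Bro)(\mathbb R_+)$, $X$ is $(d,\mathcal R)$-complete, $\mathcal R$ is $d$-almost-selfclosed, and $T$ is $\mathcal R$-increasing and $\mathcal R$-semi-progressive, then $T$ is $\mathcal S^\omega$-global strongly Picard (modulo $(d,\mathcal R)$). Definitions. $T$ is strongly $(d,\mathcal R)$-asymptotic if $x\mathcal R y$ implies $\sum_n d(T^nx,T^ny)<\infty$. $T$ is left $(d,\mathcal R)$-continuous if, for each sequence $(u_n)$ in $X$ and each $u\in X$, $u_n\to u$ in $d$ together with $u_n\mathcal R u$ for all $n$ implies $Tu_n\to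 Tu$ in $d$. $T$ is $(d,\mathcal R;\varphi)$-contractive if $d(Tx,Ty)\le\varphi(d(x,y))$ whenever $x\mathcal R y$. $\mathcal F_0(in,re;Bro)(\mathbb R_+)$ is the class of functions $\varphi:\mathbb R_+\to\mathbb R_+$ with $\varphi(0)=0$ that are increasing ($s\le t$ implies $\varphi(s)\le\varphi(t)$), regressive ($\varphi(t)<t$ for all $t>0$), and Browder admissible: every sequence $(t_n)_{n\ge0}$ in $\mathbb R_+^0$ with $t_{n+1}\le\varphi(t_n)$ for all $n$ satisfies $\sum_n t_n<\infty$. A sequence $(z_n)$ is $\mathcal R$-ascending if $z_i\mathcal R z_{i+1}$ for every $i$. $X$ is $(d,\mathcal R)$-complete if every $\mathcal R$-ascending $d$-Cauchy sequence is $d$-convergent in $X$. $\mathcal R$ is $d$-almost-selfclosed if, whenever $(z_n)$ is $\mathcal R$-ascending and $d$-converges to $z$, there is a subsequence $(w_n)$ of $(z_n)$ with $w_n\mathcal R z$ for all $n$. $T$ is $\mathcal R$-increasing if $x\mathcal R y$ implies $Tx\mathcal R Ty$. $X(T,\mathcal R)=\{x\in X: x\mathcal R Tx\}$; $T$ is $\mathcal R$-semi-progressive if $X(T,\mathcal R)\ne\emptyset$. $x\mathcal S^\omega y$ iff there are $k\ge2$ and $z_1,\dots,z_k\in X$ with $z_1=x$, $z_k=y$, $z_i\mathcal S z_{i+1}$ for $1\le i\le k-1$. $T$ is $\mathcal S^\omega$-global strongly Picard (modulo $(d,\mathcal R)$) if for each $x\in X(T,\mathcal R)$ the sequence $(T^nx)_{n\ge0}$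 is $d$-convergent with limit in $\mathrm{Fix}(T)$, and for all $z_1,z_2\in\mathrm{Fix}(T)$, $z_1\mathcal S^\omega z_2$ implies $z_1=z_2$. *)

theory Defs
  imports "HOL-Analysis.Abstract_Metric_Spaces"
begin

(* Metric_space asks for nonnegativity and symmetry of d on the whole type, not only on X. This is
   no restriction: a metric on X extends by 0, and only its values on X matter below. *)
locale relational_metric_map = Metric_space X d
  for X :: "'a set" and d :: "'a \<Rightarrow> 'a \<Rightarrow> real" +
  fixes R :: "'a rel" and T :: "'a \<Rightarrow> 'a"
  assumes carrier_nonempty: "X \<noteq> {}"
    and rel_subset: "R \<subseteq> X \<times> X"
    and rel_refl: "refl_on X R"
    and map_into: "T \<in> X \<rightarrow> X"

abbreviation converges_to :: "'a set \<Rightarrow> ('a \<Rightarrow> 'a \<Rightarrow> real) \<Rightarrow> (nat \<Rightarrow> 'a) \<Rightarrow> 'a \<Rightarrow> bool"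
  where "converges_to X d u l \<equiv> limitin (Metric_space.mtopology X d) u l sequentially"

definition Fix :: "'a set \<Rightarrow> ('a \<Rightarrow> 'a) \<Rightarrow> 'a set"
  where "Fix X T = {x \<in> X. T x = x}"

definition strongly_asymptotic :: "('a \<Rightarrow> 'a \<Rightarrow> real) \<Rightarrow> 'a rel \<Rightarrow> ('a \<Rightarrow> 'a) \<Rightarrow> bool"
  where "strongly_asymptotic d R T \<longleftrightarrow>
    (\<forall>x y. (x, y) \<in> R \<longrightarrow> summable (\<lambda>n. d ((T ^^ n) x) ((T ^^ n) y)))"

definition left_continuous ::
    "'a set \<Rightarrow> ('a \<Rightarrow> 'a \<Rightarrow> real) \<Rightarrow> 'a rel \<Rightarrow> ('a \<Rightarrow> 'a) \<Rightarrow> bool"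
  where "left_continuous X d R T \<longleftrightarrow>
    (\<forall>u l. range u \<subseteq> X \<and> l \<in> X \<and> converges_to X d u l \<and> (\<forall>n. (u n, l) \<in> R)
      \<longrightarrow> converges_to X d (\<lambda>n. T (u n)) (T l))"

definition contractive ::
    "('a \<Rightarrow> 'a \<Rightarrow> real) \<Rightarrow> 'a rel \<Rightarrow> (real \<Rightarrow> real) \<Rightarrow> ('a \<Rightarrow> 'a) \<Rightarrow> bool"
  where "contractive d R \<phi> T \<longleftrightarrow> (\<forall>x y. (x, y) \<in> R \<longrightarrow> d (T x) (T y) \<le> \<phi> (d x y))"

definition regressive :: "(real \<Rightarrow> real) \<Rightarrow> bool"
  where "regressive \<phi> \<longleftrightarrow> (\<forall>t>0. \<phi> t < t)"

definition Browder_admissible :: "(real \<Rightarrow> real) \<Rightarrow> bool"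
  where "Browder_admissible \<phi> \<longleftrightarrow>
    (\<forall>t :: nat \<Rightarrow> real. (\<forall>n. 0 < t n) \<and> (\<forall>n. t (Suc n) \<le> \<phi> (t n)) \<longrightarrow> summable t)"

(* Self-maps of the half-line [0,\<infinity>), as real functions with arbitrary values on negative
   arguments. *)
definition F0_in_re_Bro :: "(real \<Rightarrow> real) set"
  where "F0_in_re_Bro =
    {\<phi>. \<phi> \<in> {0..} \<rightarrow> {0..} \<and> \<phi> 0 = 0 \<and> mono_on {0..} \<phi> \<and> regressive \<phi> \<and> Browder_admissible \<phi>}"

definition ascending :: "'a rel \<Rightarrow> (nat \<Rightarrow> 'a) \<Rightarrow> bool"
  where "ascending R z \<longleftrightarrow> (\<forall>i. (z i, z (Suc i)) \<in> R)"

definition rel_complete :: "'a set \<Rightarrow> ('a \<Rightarrow> 'a \<Rightarrow> real) \<Rightarrow> 'a rel \<Rightarrow> bool"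
  where "rel_complete X d R \<longleftrightarrow>
    (\<forall>z. ascending R z \<and> Metric_space.MCauchy X d z \<longrightarrow> (\<exists>l. converges_to X d z l))"

definition almost_selfclosed :: "'a set \<Rightarrow> ('a \<Rightarrow> 'a \<Rightarrow> real) \<Rightarrow> 'a rel \<Rightarrow> bool"
  where "almost_selfclosed X d R \<longleftrightarrow>
    (\<forall>z l. ascending R z \<and> converges_to X d z l
      \<longrightarrow> (\<exists>r :: nat \<Rightarrow> nat. strict_mono r \<and> (\<forall>n. (z (r n), l) \<in> R)))"

definition rel_increasing :: "'a rel \<Rightarrow> ('a \<Rightarrow> 'a) \<Rightarrow> bool"
  where "rel_increasing R T \<longleftrightarrow> (\<forall>x y. (x, y) \<in> R \<longrightarrow> (T x, T y) \<in> R)"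

definition progressive_points :: "'a set \<Rightarrow> ('a \<Rightarrow> 'a) \<Rightarrow> 'a rel \<Rightarrow> 'a set"
  where "progressive_points X T R = {x \<in> X. (x, T x) \<in> R}"

definition semi_progressive :: "'a set \<Rightarrow> 'a rel \<Rightarrow> ('a \<Rightarrow> 'a) \<Rightarrow> bool"
  where "semi_progressive X R T \<longleftrightarrow> progressive_points X T R \<noteq> {}"

definition chain_rel :: "'a set \<Rightarrow> 'a rel \<Rightarrow> 'a rel"
  where "chain_rel X S =
    {(x, y). \<exists>(k::nat) (z :: nat \<Rightarrow> 'a). 2 \<le> k \<and> (\<forall>i\<in>{1..k}. z i \<in> X) \<and> z 1 = x \<and> z k = y
      \<and> (\<forall>i\<in>{1..k-1}. (z i, z (i + 1)) \<in> S)}"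

definition global_strongly_Picard ::
    "'a set \<Rightarrow> ('a \<Rightarrow> 'a \<Rightarrow> real) \<Rightarrow> 'a rel \<Rightarrow> ('a \<Rightarrow> 'a) \<Rightarrow> bool"
  where "global_strongly_Picard X d R T \<longleftrightarrow>
    (\<forall>x \<in> progressive_points X T R. \<exists>l \<in> Fix X T. converges_to X d (\<lambda>n. (T ^^ n) x) l) \<and>
    (\<forall>z1 \<in> Fix X T. \<forall>z2 \<in> Fix X T. (z1, z2) \<in> chain_rel X (R \<union> R\<inverse>) \<longrightarrow> z1 = z2)"

(* HOL cannot quantify over types inside a formula, so each of the two statements is a
   proposition about all structures whose carrier is a subset of a given type. *)
definition K_asy_rms :: "'a itself \<Rightarrow> bool"
  where "K_asy_rms (_ :: 'a itself) \<longleftrightarrow>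
    (\<forall>(X :: 'a set) d R T.
      relational_metric_map X d R T \<and>
      strongly_asymptotic d R T \<and>
      left_continuous X d R T \<and>
      rel_complete X d R \<and>
      almost_selfclosed X d R \<and>
      rel_increasing R T \<and>
      semi_progressive X R T
      \<longrightarrow> global_strongly_Picard X d R T)"

definition AI_fct_rms :: "'a itself \<Rightarrow> bool"
  where "AI_fct_rms (_ :: 'a itself) \<longleftrightarrow>
    (\<forall>(X :: 'a set) d R T.
      relational_metric_map X d R T \<and>
      (\<exists>\<phi> \<in> F0_in_re_Bro. contractive d R \<phi> T) \<and>
      rel_complete X d R \<and>
      almost_selfclosed X d R \<and>
      rel_increasing R T \<and>
      semi_progressive X R T
      \<longrightarrow> global_strongly_Picard X d R T)"

end

theory Submission
  imports Defs
begin

text \<open>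
  The contraction hypothesis entails the two hypotheses of \<open>K_asy_rms\<close> that \<open>AI_fct_rms\<close> lacks,
  strong asymptoticity and left continuity. Along a related pair the distances of the
  iterates obey the recursion \<open>t (Suc n) \<le> \<phi> (t n)\<close>, because \<open>T\<close> preserves the relation; Browder
  admissibility is the summability of such sequences, provided that they stay positive, and
  \<open>\<phi> 0 = 0\<close> takes care of those that reach zero
  (\<open>contractive_imp_strongly_asymptotic\<close>). On the other hand \<open>\<phi> t \<le> t\<close> makes \<open>T\<close> nonexpansive on
  related pairs, which is continuity along sequences related to their limit
  (\<open>contractive_imp_left_continuous\<close>).
\<close>

text \<open>Browder admissibility speaks of positive sequences only. A sequence of the same kind that
  vanishes once stays at zero from there on, so that its series is a finite sum.\<close>

lemma Browder_admissible_summable: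
  assumes bro: "Browder_admissible \<phi>" and zero: "\<phi> 0 = 0"
    and nonneg: "\<And>n. 0 \<le> t n" and rec: "\<And>n. t (Suc n) \<le> \<phi> (t n)"
  shows "summable t"
proof (cases "\<forall>n. 0 < t n")
  case True
  then show ?thesis
    using bro rec unfolding Browder_admissible_def by blast
next
  case False
  then obtain m where m: "t m = 0"
    using nonneg by (metis less_eq_real_def)
  have "t n = 0" if "m \<le> n" for n
    using that
  proof (induction n rule: dec_induct)
    case base
    show ?case by (rule m)
  next
    case (step n)
    then show ?case
      using rec[of n] zero nonneg[of "Suc n"] by simp
  qed
  then show ?thesis
    by (intro summable_finite[of "{..<m}"]) auto
qed

lemma rel_increasing_funpow:
  assumes "rel_increasing R T" "(x, y) \<in> R"
  shows "((T ^^ n) x, (T ^^ n) y) \<in> R"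
  using assms by (induction n) (auto simp: rel_increasing_def)

context relational_metric_map
begin

lemma contractive_imp_strongly_asymptotic:
  assumes "contractive d R \<phi> T" "rel_increasing R T" "Browder_admissible \<phi>" "\<phi> 0 = 0"
  shows "strongly_asymptotic d R T"
  unfolding strongly_asymptotic_def
proof (intro allI impI)
  fix x y assume "(x, y) \<in> R"
  then have "d ((T ^^ Suc n) x) ((T ^^ Suc n) y) \<le> \<phi> (d ((T ^^ n) x) ((T ^^ n) y))" for n
    using assms(1) rel_increasing_funpow[OF assms(2)] by (simp add: contractive_def)
  then show "summable (\<lambda>n. d ((T ^^ n) x) ((T ^^ n) y))"
    by (intro Browder_admissible_summable[OF assms(3,4)] nonneg)
qed

lemma contractive_imp_left_continuous:
  assumes contr: "contractive d R \<phi> T" and reg: "regressive \<phi>" and zero: "\<phi> 0 = 0"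
  shows "left_continuous X d R T"
proof -
  have le: "\<phi> t \<le> t" if "0 \<le> t" for t
    using that reg zero by (cases "t = 0") (auto simp: regressive_def less_imp_le)
  have nonexpansive: "d (T x) (T y) \<le> d x y" if "(x, y) \<in> R" for x y
    using contr that le[OF nonneg] unfolding contractive_def by (meson order_trans)
  have "converges_to X d (\<lambda>n. T (u n)) (T l)"
    if "converges_to X d u l" and rel: "\<And>n. (u n, l) \<in> R" for u l
    unfolding limitin_metric
  proof (intro conjI allI impI)
    show "T l \<in> X"
      using rel rel_subset map_into by blast
  next
    fix \<epsilon> :: real assume "0 < \<epsilon>"
    then have "\<forall>\<^sub>F n in sequentially. u n \<in> X \<and> d (u n) l < \<epsilon>"
      using \<open>converges_to X d u l\<close> by (simp add: limitin_metric)
    then show "\<forall>\<^sub>F n in sequentially. T (u n) \<in> X \<and> d (T (u n)) (T l) < \<epsilon>"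
    proof (rule eventually_mono)
      fix n assume "u n \<in> X \<and> d (u n) l < \<epsilon>"
      then show "T (u n) \<in> X \<and> d (T (u n)) (T l) < \<epsilon>"
        using map_into nonexpansive[OF rel, of n] by auto
    qed
  qed
  then show ?thesis
    by (auto simp: left_continuous_def)
qed

end

theorem proposition3p1:
  assumes "K_asy_rms TYPE('a)"
  shows "AI_fct_rms TYPE('a)"
  unfolding AI_fct_rms_def
proof (intro allI impI, elim conjE bexE)
  fix X :: "'a set" and d R T \<phi>
  assume map: "relational_metric_map X d R T"
    and \<phi>: "\<phi> \<in> F0_in_re_Bro" "contractive d R \<phi> T"
    and rest: "rel_complete X d R" "almost_selfclosed X d R" "rel_increasing R T"
      "semi_progressive X R T"
  interpret relational_metric_map X d R T by (rule map)
  have "strongly_asymptotic d R T" "left_continuous X d R T"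
    using \<phi> rest(3) contractive_imp_strongly_asymptotic contractive_imp_left_continuous
    by (auto simp: F0_in_re_Bro_def)
  then show "global_strongly_Picard X d R T"
    using assms map rest unfolding K_asy_rms_def by blast
qed

end
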